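(* Let $f:\mathbb{R}^n\times\mathbb{R}\to\mathbb{R}^n$ be real analytic, and let $A$, $R=R^{\rm T}$, $Q=Q^{\rm T}$ be $n\times n$ matrices whose entries are real analytic real-valued functions of $(x,t)\in\mathbb{R}^n\times\mathbb{R}$. Consider the differential Riccati equation for an unknown $X\in\mathcal{K}^{n\times n}$, $$\delta_f(X)+XA+A^{\rm T}X-XRX=-Q, \qquad (\mathrm{DRE})$$ and the differential Hamiltonian matrix $$\mathcal{H}=\begin{bmatrix}A&-R\\ -Q&-A^{\rm T}\end{bmatrix}\in\mathcal{K}_{\mathbb{R}}^{2n\times 2n}.$$ (First part) Assume that there exists an $n$-dimensional (right) $\mathcal{H}$ invariant subspace $W\subset\mathcal{K}^{2n}$, and consider matrices $U,V\in\mathcal{K}^{n\times n}$ such that $$W={\rm Im}\begin{bmatrix}U\\ V\end{bmatrix}.$$ If $U$ is regular, then $X:=VU^{-1}\in\mathcal{K}^{n\times n}$ is a solution to (DRE) and satisfies $${\rm rspec}_f(A-RX)={\rm rspec}_f(\mathcal{H}|_W).$$ (Converse part) Conversely, if $X\in\mathcal{K}^{n\times n}$ is a solution to (DRE), then there exist $U,V\in\mathcal{K}^{n\times n}$ such that $U$ is regular and $X=VU^{-1}$. Moreover, for these $U$ and $V$, the subspace $W:={\rm Im}\begin{bmatrix}U\\ V\end{bmatrix}\subset\mathcal{K}^{2n}$ is an $n$-dimensional (right) $\mathcal{H}$ invariant subspace and satisfies ${\rm rspec}_f(A-RX)={\rm rspec}_f(\mathcal{H}|_W)$.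
   Context: Notation. $\mathcal{K}_{\mathbb{R}}$ is the field of real meromorphic functions (quotients of real analytic functions) in the variables $x_1,\dots,x_n,t$ with domain $\mathbb{R}^n\times\mathbb{R}$, and $\mathcal{K}=\{a+bj: a,b\in\mathcal{K}_{\mathbb{R}}\}$, where $j$ is the imaginary unit; $\mathcal{K}$ is a field. Linear subspaces, dimension, rank and image (${\rm Im}$, the column span) are over $\mathcal{K}$. A square matrix over $\mathcal{K}$ is called regular if it has full rank over $\mathcal{K}$ (i.e. is invertible over $\mathcal{K}$). For the real analytic $f:\mathbb{R}^n\times\mathbb{R}\to\mathbb{R}^n$, the operator $\delta_f:\mathcal{K}\to\mathcal{K}$ is $$\delta_f(a)=\frac{\partial a}{\partial t}+\frac{\partial a}{\partial x}f,$$ and it is applied entrywise to vectors and matrices; $\mathcal{K}$ is a differential field with respect to $\delta_f$. Right eigenvalues: for $M\in\mathcal{K}^{m\times m}$, a vector $w\in\mathcal{K}^m\setminus\{0\}$ is a right eigenvector associated with the right eigenvalue $\beta\in\mathcal{K}$ if $Mw-\delta_f(w)=\beta w$. The set of right eigenvalues of $M$ is denoted ${\rm rspec}_f(M)$. A linear subspace $W\subset\mathcal{K}^{2n}$ is (right) $\mathcal{H}$ invariant if $\mathcal{H}W-\delta_f(W)\subset W$, i.e. $\mathcal{H}w-\delta_f(w)\in W$ for all $w\in W$. For such $W$, $${\rm rspec}_f(\mathcal{H}|_W):=\{\beta\in\mathcal{K}:\ \mathcal{H}w-\delta_f(w)=\beta w\ \text{for some } w\in W\setminus\{0\}\}.$$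 *)

theory Defs
  imports "HOL-Analysis.Analysis" "HOL-Computational_Algebra.Fraction_Field"
begin

definition multi_indices :: "('a::euclidean_space \<Rightarrow> nat) set" where
  "multi_indices = {\<alpha>. \<forall>b. b \<notin> Basis \<longrightarrow> \<alpha> b = 0}"

definition monomial :: "('a::euclidean_space \<Rightarrow> nat) \<Rightarrow> 'a \<Rightarrow> real" where
  "monomial \<alpha> z = (\<Prod>b\<in>Basis. (z \<bullet> b) ^ \<alpha> b)"

text \<open>Local expandability into a power series in the coordinates; multi-indices are functions on
  the type that vanish off the standard basis, and \<open>has_sum\<close> is unconditional convergence.\<close>

definition real_analytic :: "('a::euclidean_space \<Rightarrow> real) \<Rightarrow> bool" where
  "real_analytic f \<longleftrightarrow>
     (\<forall>p. \<exists>r>0. \<exists>c. \<forall>z\<in>ball p r. ((\<lambda>\<alpha>. c \<alpha> * monomial \<alpha> (z - p)) has_sum f z) multi_indices)"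

lemma real_analytic_const: "real_analytic (\<lambda>_. k)"
proof -
  have "((\<lambda>\<alpha>. (if \<alpha> = (\<lambda>_. 0) then k else 0) * monomial \<alpha> (z - p)) has_sum k) multi_indices" for z p :: 'a
    by (rule has_sum_finite_neutralI[where B="{\<lambda>_. 0}"]) (auto simp: multi_indices_def monomial_def)
  then show ?thesis
    unfolding real_analytic_def by (intro allI exI[of _ 1]) (auto intro!: exI)
qed

lemma real_analytic_add:
  assumes "real_analytic f" "real_analytic g"
  shows "real_analytic (\<lambda>z. f z + g z)"
  unfolding real_analytic_def
proof
  fix p
  obtain r c where 1: "r > 0" "\<forall>z\<in>ball p r. ((\<lambda>\<alpha>. c \<alpha> * monomial \<alpha> (z - p)) has_sum f z) multi_indices"
    using assms(1) unfolding real_analytic_def by blast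
  obtain r' c' where 2: "r' > 0" "\<forall>z\<in>ball p r'. ((\<lambda>\<alpha>. c' \<alpha> * monomial \<alpha> (z - p)) has_sum g z) multi_indices"
    using assms(2) unfolding real_analytic_def by blast
  show "\<exists>r>0. \<exists>c. \<forall>z\<in>ball p r. ((\<lambda>\<alpha>. c \<alpha> * monomial \<alpha> (z - p)) has_sum f z + g z) multi_indices"
  proof (intro exI[of _ "min r r'"] conjI exI[of _ "\<lambda>\<alpha>. c \<alpha> + c' \<alpha>"] ballI)
    fix z assume "z \<in> ball p (min r r')"
    then show "((\<lambda>\<alpha>. (c \<alpha> + c' \<alpha>) * monomial \<alpha> (z - p)) has_sum f z + g z) multi_indices"
      using has_sum_add[OF 1(2)[rule_format, of z] 2(2)[rule_format, of z]]
      by (simp add: distrib_right)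
  qed (use 1 2 in auto)
qed

lemma has_sum_mult_real:
  fixes f g :: "_ \<Rightarrow> real"
  assumes "(f has_sum x) A" "(g has_sum y) B"
  shows "((\<lambda>(a,b). f a * g b) has_sum x * y) (A \<times> B)"
proof (rule has_sum_SigmaI)
  fix a assume "a \<in> A"
  show "((\<lambda>b. case (a, b) of (a, b) \<Rightarrow> f a * g b) has_sum f a * y) B"
    using has_sum_cmult_right[OF assms(2), of "f a"] by simp
next
  show "((\<lambda>a. f a * y) has_sum x * y) A"
    by (rule has_sum_cmult_left[OF assms(1)])
next
  have f: "(\<lambda>a. norm (f a)) summable_on A" and g: "(\<lambda>b. norm (g b)) summable_on B"
    using assms summable_on_iff_abs_summable_on_real has_sum_imp_summable by blast+
  have "(\<lambda>x. norm ((\<lambda>(a,b). f a * g b) x)) summable_on (A \<times> B)"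
    unfolding Infinite_Sum.abs_summable_on_Sigma_iff
  proof (intro conjI ballI)
    fix a assume "a \<in> A"
    show "(\<lambda>b. norm (case (a, b) of (a, b) \<Rightarrow> f a * g b)) summable_on B"
      using summable_on_cmult_right[OF g, of "\<bar>f a\<bar>"] by (simp add: abs_mult)
  next
    have "(\<lambda>a. norm (f a) * infsum (\<lambda>b. norm (g b)) B) summable_on A"
      by (rule summable_on_cmult_left[OF f])
    moreover have "infsum (\<lambda>b. \<bar>g b\<bar>) B \<ge> 0" by (rule infsum_nonneg) auto
    ultimately show "(\<lambda>x. norm (\<Sum>\<^sub>\<infinity>b\<in>B. norm (case (x, b) of (a, b) \<Rightarrow> f a * g b))) summable_on A"
      by (simp add: abs_mult infsum_cmult_right')
  qed
  then show "(\<lambda>(a, b). f a * g b) summable_on A \<times> B"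
    by (rule summable_on_iff_abs_summable_on_real[THEN iffD2])
qed

lemma monomial_add: "monomial (\<lambda>b. \<alpha> b + \<beta> b) z = monomial \<alpha> z * monomial \<beta> z"
  by (simp add: monomial_def power_add prod.distrib)

lemma finite_bounded_multi_indices: "finite {\<alpha> \<in> multi_indices. \<forall>b. \<alpha> b \<le> N b}"
proof -
  have "{\<alpha> \<in> multi_indices. \<forall>b. \<alpha> b \<le> N b} \<subseteq>
    {\<alpha>. \<forall>x. (x \<in> Basis \<longrightarrow> \<alpha> x \<in> {..Max (N ` Basis)}) \<and> (x \<notin> Basis \<longrightarrow> \<alpha> x = 0)}"
  proof -
    have "N x \<le> Max (N ` Basis)" if "x \<in> Basis" for x using that by simp
    then show ?thesis by (auto simp: multi_indices_def intro: order_trans)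
  qed
  then show ?thesis
    by (rule finite_subset) (intro finite_set_of_finite_funs, auto)
qed

lemma real_analytic_mult:
  assumes "real_analytic f" "real_analytic g"
  shows "real_analytic (\<lambda>z. f z * g z)"
  unfolding real_analytic_def
proof
  fix p
  obtain r c where 1: "r > 0" "\<forall>z\<in>ball p r. ((\<lambda>\<alpha>. c \<alpha> * monomial \<alpha> (z - p)) has_sum f z) multi_indices"
    using assms(1) unfolding real_analytic_def by blast
  obtain r' c' where 2: "r' > 0" "\<forall>z\<in>ball p r'. ((\<lambda>\<alpha>. c' \<alpha> * monomial \<alpha> (z - p)) has_sum g z) multi_indices"
    using assms(2) unfolding real_analytic_def by blast
  define S where "S \<gamma> = {(\<alpha>,\<beta>). \<alpha> \<in> multi_indices \<and> \<beta> \<in> multi_indices \<and> (\<lambda>b. \<alpha> b + \<beta> b) = \<gamma>}" for \<gamma> :: "'a \<Rightarrow> nat"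
  define d where "d \<gamma> = (\<Sum>(\<alpha>,\<beta>)\<in>S \<gamma>. c \<alpha> * c' \<beta>)" for \<gamma>
  have fin: "finite (S \<gamma>)" for \<gamma>
  proof -
    have "S \<gamma> \<subseteq> {\<alpha> \<in> multi_indices. \<forall>b. \<alpha> b \<le> \<gamma> b} \<times> {\<alpha> \<in> multi_indices. \<forall>b. \<alpha> b \<le> \<gamma> b}"
      by (auto simp: S_def)
    then show ?thesis
      by (rule finite_subset) (intro finite_cartesian_product finite_bounded_multi_indices)
  qed
  show "\<exists>r>0. \<exists>c. \<forall>z\<in>ball p r. ((\<lambda>\<alpha>. c \<alpha> * monomial \<alpha> (z - p)) has_sum f z * g z) multi_indices"
  proof (intro exI[of _ "min r r'"] conjI exI[of _ d] ballI)
    fix z assume z: "z \<in> ball p (min r r')"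
    let ?m = "\<lambda>\<alpha>. monomial \<alpha> (z - p)"
    have "((\<lambda>(\<alpha>,\<beta>). (c \<alpha> * ?m \<alpha>) * (c' \<beta> * ?m \<beta>)) has_sum f z * g z) (multi_indices \<times> multi_indices)"
      by (rule has_sum_mult_real) (use 1 2 z in auto)
    also have "?this \<longleftrightarrow> ((\<lambda>(\<gamma>,(\<alpha>,\<beta>)). (c \<alpha> * c' \<beta>) * ?m \<gamma>) has_sum f z * g z) (Sigma multi_indices S)"
      by (rule has_sum_reindex_bij_witness[where i = snd and j = "\<lambda>(\<alpha>,\<beta>). (\<lambda>b. \<alpha> b + \<beta> b, \<alpha>, \<beta>)"])
         (auto simp: S_def multi_indices_def monomial_add)
    finally have *: "((\<lambda>(\<gamma>,(\<alpha>,\<beta>)). (c \<alpha> * c' \<beta>) * ?m \<gamma>) has_sum f z * g z) (Sigma multi_indices S)" .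
    show "((\<lambda>\<gamma>. d \<gamma> * ?m \<gamma>) has_sum f z * g z) multi_indices"
      by (rule has_sum_SigmaD[OF *])
         (use fin in \<open>auto simp: d_def sum_distrib_right case_prod_unfold intro!: has_sum_finiteI\<close>)
  qed (use 1 2 in auto)
qed

text \<open>Restricting to lines reduces the absence of zero divisors to one variable.\<close>

definition line_analytic :: "(real \<Rightarrow> real) \<Rightarrow> bool" where
  "line_analytic h \<longleftrightarrow> (\<forall>s0. \<exists>r>0. \<exists>a. \<forall>u. \<bar>u\<bar> < r \<longrightarrow> (\<lambda>n. a n * u ^ n) sums h (s0 + u))"

lemma monomial_scaleR: "monomial \<alpha> (u *\<^sub>R v) = u ^ (\<Sum>b\<in>Basis. \<alpha> b) * monomial \<alpha> v"
  by (simp add: monomial_def power_mult_distrib prod.distrib power_sum)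

lemma line_analytic_restrict:
  assumes "real_analytic f"
  shows "line_analytic (\<lambda>s. f (q + s *\<^sub>R v))"
  unfolding line_analytic_def
proof
  fix s0
  define p where "p = q + s0 *\<^sub>R v"
  obtain r c where 1: "r > 0" "\<forall>z\<in>ball p r. ((\<lambda>\<alpha>. c \<alpha> * monomial \<alpha> (z - p)) has_sum f z) multi_indices"
    using assms(1) unfolding real_analytic_def by blast
  define S :: "nat \<Rightarrow> ('a \<Rightarrow> nat) set" where "S n = {\<alpha> \<in> multi_indices. (\<Sum>b\<in>Basis. \<alpha> b) = n}" for n
  define a where "a n = (\<Sum>\<alpha>\<in>S n. c \<alpha> * monomial \<alpha> v)" for n
  have fin: "finite (S n)" for n
  proof -
    have "S n \<subseteq> {\<alpha> \<in> multi_indices. \<forall>b. \<alpha> b \<le> n}"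
    proof safe
      fix \<alpha> and b :: 'a assume *: "\<alpha> \<in> S n"
      show "\<alpha> b \<le> n"
      proof (cases "b \<in> Basis")
        case True
        then have "\<alpha> b \<le> (\<Sum>b\<in>Basis. \<alpha> b)" by (intro member_le_sum) auto
        then show ?thesis using * by (simp add: S_def)
      qed (use * in \<open>auto simp: S_def multi_indices_def\<close>)
    qed (auto simp: S_def)
    then show ?thesis by (rule finite_subset) (rule finite_bounded_multi_indices)
  qed
  show "\<exists>r>0. \<exists>a. \<forall>u. \<bar>u\<bar> < r \<longrightarrow> (\<lambda>n. a n * u ^ n) sums f (q + (s0 + u) *\<^sub>R v)"
  proof (intro exI[of _ "r / (norm v + 1)"] conjI exI[of _ a] allI impI)
    show "0 < r / (norm v + 1)" using 1 by (simp add: add_nonneg_pos)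
    fix u :: real assume u: "\<bar>u\<bar> < r / (norm v + 1)"
    have "\<bar>u\<bar> * norm v \<le> \<bar>u\<bar> * (norm v + 1)" by (intro mult_left_mono) auto
    also have "\<dots> < r" using u by (simp add: pos_less_divide_eq add_nonneg_pos)
    finally have "p + u *\<^sub>R v \<in> ball p r" by (simp add: dist_norm)
    from 1(2)[rule_format, OF this]
    have "((\<lambda>\<alpha>. c \<alpha> * monomial \<alpha> (u *\<^sub>R v)) has_sum f (p + u *\<^sub>R v)) multi_indices" by simp
    also have "?this \<longleftrightarrow> ((\<lambda>(n,\<alpha>). c \<alpha> * monomial \<alpha> v * u ^ n) has_sum f (p + u *\<^sub>R v)) (Sigma UNIV S)"
      by (rule has_sum_reindex_bij_witness[where i = snd and j = "\<lambda>\<alpha>. (\<Sum>b\<in>Basis. \<alpha> b, \<alpha>)"])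
         (auto simp: S_def monomial_scaleR)
    finally have *: "((\<lambda>(n,\<alpha>). c \<alpha> * monomial \<alpha> v * u ^ n) has_sum f (p + u *\<^sub>R v)) (Sigma UNIV S)" .
    have "((\<lambda>n. a n * u ^ n) has_sum f (p + u *\<^sub>R v)) UNIV"
      by (rule has_sum_SigmaD[OF *])
         (use fin in \<open>auto simp: a_def sum_distrib_right intro!: has_sum_finiteI\<close>)
    then show "(\<lambda>n. a n * u ^ n) sums f (q + (s0 + u) *\<^sub>R v)"
      using has_sum_imp_sums by (simp add: p_def algebra_simps)
  qed
qed

lemma powser_isolated_zero:
  fixes h :: "real \<Rightarrow> real"
  assumes "r > 0" "\<And>u. \<bar>u\<bar> < r \<Longrightarrow> (\<lambda>n. a n * u ^ n) sums h u" and ne: "a n \<noteq> 0"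
  shows "\<forall>\<^sub>F u in at 0. h u \<noteq> 0"
proof -
  define m where "m = (LEAST n. a n \<noteq> 0)"
  have am: "a m \<noteq> 0" unfolding m_def by (rule LeastI[of "\<lambda>n. a n \<noteq> 0", OF ne])
  have lt: "a k = 0" if "k < m" for k
    using not_less_Least[of k "\<lambda>n. a n \<noteq> 0"] that unfolding m_def by blast
  have s: "(\<lambda>n. a (n + m) * u ^ n) sums (h u / u ^ m)" if "u \<noteq> 0" "norm u < r" for u
  proof -
    have "(\<lambda>n. a (n + m) * u ^ (n + m)) sums h u"
      using assms(2)[of u] that lt by (subst sums_zero_iff_shift) auto
    from sums_divide[OF this, of "u ^ m"] show ?thesis
      using that by (simp add: power_add)
  qed
  have "((\<lambda>u. h u / u ^ m) \<longlongrightarrow> a (0 + m)) (at 0)"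
    by (rule powser_limit_0_strong[OF \<open>r > 0\<close> s]) auto
  then have "\<forall>\<^sub>F u in at 0. h u / u ^ m \<noteq> 0"
    using am by (intro tendsto_imp_eventually_ne) auto
  then show ?thesis by (rule eventually_mono) auto
qed

lemma line_analytic_dichotomy:
  assumes "line_analytic h"
  shows "(\<forall>\<^sub>F s in nhds s0. h s = 0) \<or> (\<forall>\<^sub>F s in at s0. h s \<noteq> 0)"
proof -
  obtain r a where r: "r > 0" and a: "\<And>u. \<bar>u\<bar> < r \<Longrightarrow> (\<lambda>n. a n * u ^ n) sums h (s0 + u)"
    using assms unfolding line_analytic_def by meson
  show ?thesis
  proof (cases "\<exists>n. a n \<noteq> 0")
    case True
    then obtain n where "a n \<noteq> 0" by blast
    from powser_isolated_zero[of r a "\<lambda>u. h (s0 + u)", OF r a this]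
    have "\<forall>\<^sub>F u in at 0. h (s0 + u) \<noteq> 0" .
    then have "\<forall>\<^sub>F u in at s0. h u \<noteq> 0"
      by (subst at_to_0) (simp add: eventually_filtermap add.commute)
    then show ?thesis ..
  next
    case False
    have "h s = 0" if "\<bar>s - s0\<bar> < r" for s
      using a[OF that] False sums_unique2[OF sums_zero] by fastforce
    then have "\<forall>\<^sub>F s in nhds s0. h s = 0"
      unfolding eventually_nhds_metric using r by (auto simp: dist_real_def)
    then show ?thesis ..
  qed
qed

lemma line_analytic_mult_eq_0:
  assumes g: "line_analytic g" and h: "line_analytic h" and gh: "\<And>s. g s * h s = 0"
  shows "(\<forall>s. g s = 0) \<or> (\<forall>s. h s = 0)"
proof -
  define S where "S = {s. \<forall>\<^sub>F x in nhds s. g x = 0}"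
  have "open S"
    unfolding S_def by (subst open_subopen) (auto simp: eventually_nhds)
  have compl: "- S = {s. \<forall>\<^sub>F x in at s. g x \<noteq> 0}"
  proof -
    have "False" if "\<forall>\<^sub>F x in nhds s. g x = 0" "\<forall>\<^sub>F x in at s. g x \<noteq> 0" for s :: real
    proof -
      have "\<forall>\<^sub>F x in at s. g x = 0" using that(1) by (simp add: eventually_nhds_conv_at)
      with that(2) have "\<forall>\<^sub>F x in at s. False" by eventually_elim auto
      then show False by simp
    qed
    then show ?thesis using line_analytic_dichotomy[OF g] by (auto simp: S_def)
  qed
  have "open (- S)"
    unfolding open_subopen[of "- S"]
  proof
    fix s assume "s \<in> - S"
    then have "\<forall>\<^sub>F x in at s. g x \<noteq> 0" by (simp add: compl)
    then obtain T where T: "open T" "s \<in> T" "\<And>x. x \<in> T \<Longrightarrow> x \<noteq> s \<Longrightarrow> g x \<noteq> 0"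
      unfolding eventually_at_topological by blast
    have "T \<subseteq> - S"
    proof
      fix x assume x: "x \<in> T"
      show "x \<in> - S"
      proof (cases "x = s")
        case True then show ?thesis using \<open>s \<in> - S\<close> by simp
      next
        case False
        then have "g x \<noteq> 0" using T x by blast
        then show ?thesis by (auto simp: S_def dest: eventually_nhds_x_imp_x)
      qed
    qed
    then show "\<exists>T. open T \<and> s \<in> T \<and> T \<subseteq> - S" using T by blast
  qed
  then have "closed S" by (simp add: closed_def)
  with \<open>open S\<close> have "S = {} \<or> S = UNIV" using clopen[of S] by blast
  then show ?thesis
  proof
    assume "S = UNIV"
    then have "g s = 0" for s unfolding S_def by (auto dest: eventually_nhds_x_imp_x)
    then show ?thesis by blast
  next
    assume "S = {}"
    have "h s = 0" for s
    proof -
      have "\<forall>\<^sub>F x in at s. g x \<noteq> 0" using \<open>S = {}\<close> compl by blast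
      then have ev: "\<forall>\<^sub>F x in at s. h x = 0"
        by (rule eventually_mono) (metis gh mult_eq_0_iff)
      have "\<forall>\<^sub>F x in nhds s. h x = 0"
      proof (rule ccontr)
        assume "\<not> ?thesis"
        then have "\<forall>\<^sub>F x in at s. h x \<noteq> 0" using line_analytic_dichotomy[OF h] by blast
        with ev have "\<forall>\<^sub>F x in at s. False" by eventually_elim auto
        then show False by simp
      qed
      then show ?thesis by (rule eventually_nhds_x_imp_x)
    qed
    then show ?thesis by blast
  qed
qed

lemma real_analytic_mult_eq_0:
  assumes f: "real_analytic f" and g: "real_analytic g" and fg: "\<And>z. f z * g z = 0"
  shows "(\<forall>z. f z = 0) \<or> (\<forall>z. g z = 0)"
proof (rule ccontr)
  assume "\<not> ?thesis"
  then obtain p q where pq: "f p \<noteq> 0" "g q \<noteq> 0" by blast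
  have "(\<forall>s. f (p + s *\<^sub>R (q - p)) = 0) \<or> (\<forall>s. g (p + s *\<^sub>R (q - p)) = 0)"
    by (rule line_analytic_mult_eq_0) (auto intro: line_analytic_restrict f g simp: fg)
  moreover have "f (p + 0 *\<^sub>R (q - p)) \<noteq> 0" "g (p + 1 *\<^sub>R (q - p)) \<noteq> 0" using pq by auto
  ultimately show False by blast
qed


definition partial :: "'a \<Rightarrow> ('a::euclidean_space \<Rightarrow> real) \<Rightarrow> 'a \<Rightarrow> real" where
  "partial b f z = deriv (\<lambda>s. f (z + s *\<^sub>R b)) 0"

lemma monomial_split:
  assumes "b \<in> Basis"
  shows "monomial \<alpha> z = (z \<bullet> b) ^ \<alpha> b * (\<Prod>b'\<in>Basis - {b}. (z \<bullet> b') ^ \<alpha> b')"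
  using assms by (simp add: monomial_def prod.remove)

lemma monomial_upd_shift:
  assumes b: "b \<in> Basis" and \<alpha>: "\<alpha> b = 0"
  shows "monomial (\<alpha>(b := k)) (z + s *\<^sub>R b) = monomial \<alpha> z * (z \<bullet> b + s) ^ k"
proof -
  have "(\<Prod>b'\<in>Basis - {b}. ((z + s *\<^sub>R b) \<bullet> b') ^ (\<alpha>(b := k)) b') = (\<Prod>b'\<in>Basis - {b}. (z \<bullet> b') ^ \<alpha> b')"
    using b by (intro prod.cong) (auto simp: inner_add_left inner_not_same_Basis)
  then show ?thesis
    using b \<alpha> by (simp add: monomial_split[OF b] inner_add_left)
qed

lemma has_sum_multi_indices_split:
  fixes b :: "'a::euclidean_space"
  assumes b: "b \<in> Basis"
  shows "(F has_sum x) multi_indices \<longleftrightarrow>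
    ((\<lambda>(k,\<beta>). F (\<beta>(b := k))) has_sum x) (UNIV \<times> {\<beta> \<in> multi_indices. \<beta> b = 0})"
  by (rule has_sum_reindex_bij_witness[where i = "\<lambda>(k,\<beta>). \<beta>(b := k)" and j = "\<lambda>\<alpha>. (\<alpha> b, \<alpha>(b := 0))"])
     (use b in \<open>auto simp: multi_indices_def\<close>)

lemma power_series_partial:
  fixes f :: "'a::euclidean_space \<Rightarrow> real"
  assumes b: "b \<in> Basis" and r: "r > 0"
    and f: "\<And>z. z \<in> ball p r \<Longrightarrow> ((\<lambda>\<alpha>. c \<alpha> * monomial \<alpha> (z - p)) has_sum f z) multi_indices"
    and z: "z \<in> ball p r"
  shows "\<exists>D. ((\<lambda>s. f (z + s *\<^sub>R b)) has_field_derivative D) (at 0) \<and>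
    ((\<lambda>\<alpha>. (real (Suc (\<alpha> b)) * c (\<alpha>(b := Suc (\<alpha> b)))) * monomial \<alpha> (z - p)) has_sum D) multi_indices"
proof -
  define t where "t = (z - p) \<bullet> b"
  define w where "w = (z - p) - t *\<^sub>R b"
  have wb: "w \<bullet> b = 0" using b by (simp add: w_def t_def inner_diff_left)
  have nrm: "norm (w + s *\<^sub>R b) ^ 2 = norm w ^ 2 + s ^ 2" for s
    using wb b by (simp add: power2_norm_eq_inner inner_add_left inner_add_right inner_commute)
                  (simp add: power2_eq_square)
  have zp: "z - p = w + t *\<^sub>R b" by (simp add: w_def)
  have "norm w ^ 2 + t ^ 2 < r ^ 2"
    using z r unfolding nrm[symmetric] zp[symmetric]
    by (simp add: dist_norm norm_minus_commute power_strict_mono)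
  then have "t ^ 2 < r ^ 2 - norm w ^ 2" by simp
  then obtain q where q: "t ^ 2 < q" "q < r ^ 2 - norm w ^ 2" using dense by blast
  define \<rho> where "\<rho> = sqrt q"
  have q0: "q > 0" using q(1) by (meson le_less_trans zero_le_power2)
  have \<rho>: "\<rho> > 0" "\<rho> ^ 2 = q" using q0 by (auto simp: \<rho>_def)
  have t\<rho>: "\<bar>t\<bar> < \<rho>"
    using q(1) \<rho> by (intro power2_less_imp_less[of "\<bar>t\<bar>" \<rho>]) auto
  define M where "M = {\<beta> \<in> multi_indices. \<beta> b = (0::nat)}"
  define C where "C k \<beta> = c (\<beta>(b := k)) * monomial \<beta> w" for k \<beta>
  have expand: "((\<lambda>(k,\<beta>). C k \<beta> * s ^ k) has_sum f (p + w + s *\<^sub>R b)) (UNIV \<times> M)" if s: "\<bar>s\<bar> \<le> \<rho>" for s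
  proof -
    have "s ^ 2 \<le> \<rho> ^ 2" using power_mono[OF s, of 2] by simp
    then have "norm (w + s *\<^sub>R b) ^ 2 < r ^ 2" using q \<rho> by (simp add: nrm)
    then have "norm (w + s *\<^sub>R b) < r" using r by (intro power2_less_imp_less[of _ r]) auto
    then have "p + w + s *\<^sub>R b \<in> ball p r"
      by (metis (no_types) add.assoc add_diff_cancel_left' dist_commute dist_norm mem_ball)
    from f[OF this] have "((\<lambda>\<alpha>. c \<alpha> * monomial \<alpha> (w + s *\<^sub>R b)) has_sum f (p + w + s *\<^sub>R b)) multi_indices"
      by (simp add: algebra_simps)
    then have "((\<lambda>(k,\<beta>). c (\<beta>(b := k)) * monomial (\<beta>(b := k)) (w + s *\<^sub>R b)) has_sum f (p + w + s *\<^sub>R b)) (UNIV \<times> M)"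
      unfolding has_sum_multi_indices_split[OF b] M_def .
    then show ?thesis
      by (rule has_sum_cong[THEN iffD1, rotated])
         (auto simp: M_def C_def monomial_upd_shift[OF b] wb)
  qed
  have summ: "(\<lambda>(k,\<beta>). C k \<beta> * \<rho> ^ k) summable_on (UNIV \<times> M)"
    using expand[of \<rho>] \<rho> by (auto simp: summable_on_def)
  have summC: "C k summable_on M" for k
  proof -
    have "(\<lambda>\<beta>. C k \<beta> * \<rho> ^ k) summable_on M"
      using summable_on_SigmaD1[OF summ, of k] by simp
    from summable_on_cmult_left[OF this, of "inverse (\<rho> ^ k)"]
    show ?thesis using \<rho>(1) by (simp add: mult.assoc)
  qed
  define A where "A k = infsum (C k) M" for k
  have hsC: "(C k has_sum A k) M" for k
    using summC by (simp add: A_def)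
  have ser: "(\<lambda>k. A k * s ^ k) sums f (p + w + s *\<^sub>R b)" if s: "\<bar>s\<bar> \<le> \<rho>" for s
    by (rule has_sum_imp_sums, rule has_sum_SigmaD[OF expand[OF s]])
       (use has_sum_cmult_left[OF hsC] in auto)
  let ?D = "\<Sum>n. diffs A n * t ^ n"
  have "DERIV (\<lambda>x. \<Sum>n. A n * x^n) t :> ?D"
  proof (rule termdiffs_strong[of A \<rho>])
    show "summable (\<lambda>n. A n * \<rho> ^ n)" using ser[of \<rho>] \<rho>(1) sums_summable by simp
    show "norm t < norm \<rho>" using t\<rho> \<rho>(1) by simp
  qed
  moreover have "\<forall>\<^sub>F x in nhds t. (\<Sum>n. A n * x^n) = f (p + w + x *\<^sub>R b)"
  proof -
    have "\<forall>\<^sub>F x in nhds t. x \<in> {-\<rho><..<\<rho>}"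
      by (rule eventually_nhds_in_open) (use t\<rho> in auto)
    then show ?thesis
      by (rule eventually_mono) (rule sums_unique[OF ser, symmetric], force)
  qed
  ultimately have "DERIV (\<lambda>x. f (p + w + x *\<^sub>R b)) t :> ?D"
    by (subst DERIV_cong_ev[OF refl _ refl, symmetric])
  then have "DERIV (\<lambda>x. f (p + w + (x + t) *\<^sub>R b)) 0 :> ?D"
    using DERIV_shift[of "\<lambda>x. f (p + w + x *\<^sub>R b)" ?D 0 t] by simp
  moreover have "p + w + (x + t) *\<^sub>R b = z + x *\<^sub>R b" for x
    using zp by (simp add: algebra_simps)
  ultimately have der: "DERIV (\<lambda>x. f (z + x *\<^sub>R b)) 0 :> ?D" by simp
  
  obtain B where B: "\<And>n. \<bar>real (Suc n) * (t / \<rho>) ^ n\<bar> \<le> B"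
  proof -
    have "\<bar>t / \<rho>\<bar> < 1" using t\<rho> \<rho> by simp
    then have "(\<lambda>n. real n * (t / \<rho>) ^ n + (t / \<rho>) ^ n) \<longlonglongrightarrow> 0 + 0"
      by (intro tendsto_add powser_times_n_limit_0 LIMSEQ_power_zero) auto
    then have "Bseq (\<lambda>n. real n * (t / \<rho>) ^ n + (t / \<rho>) ^ n)"
      using convergentI convergent_imp_Bseq by blast
    then obtain B where "\<And>n. norm (real n * (t / \<rho>) ^ n + (t / \<rho>) ^ n) \<le> B"
      unfolding Bseq_def by blast
    then show ?thesis by (intro that[of B]) (simp add: distrib_right add.commute)
  qed
  define G where "G k \<beta> = real (Suc k) * C (Suc k) \<beta> * t ^ k" for k \<beta>
  have summG: "(\<lambda>(k,\<beta>). G k \<beta>) summable_on (UNIV \<times> M)"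
  proof -
    have "(\<lambda>(k,\<beta>). C k \<beta> * \<rho> ^ k) summable_on ({0<..} \<times> M)"
      by (rule summable_on_subset[OF summ]) auto
    then have "(\<lambda>(k,\<beta>). C (Suc k) \<beta> * \<rho> ^ Suc k) summable_on (UNIV \<times> M)"
      by (subst summable_on_reindex_bij_witness[where i = "\<lambda>(k,\<beta>). (k - 1, \<beta>)" and j = "\<lambda>(k,\<beta>). (Suc k, \<beta>)"
            and T = "{0<..} \<times> M" and h = "\<lambda>(k,\<beta>). C k \<beta> * \<rho> ^ k"]) auto
    then have "(\<lambda>x. norm ((\<lambda>(k,\<beta>). C (Suc k) \<beta> * \<rho> ^ Suc k) x)) summable_on (UNIV \<times> M)"
      by (rule summable_on_iff_abs_summable_on_real[THEN iffD1])
    then have S: "(\<lambda>x. norm ((\<lambda>(k,\<beta>). C (Suc k) \<beta> * \<rho> ^ Suc k) x) * (B / \<rho>)) summable_on (UNIV \<times> M)"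
      by (rule summable_on_cmult_left)
    have "(\<lambda>x. norm ((\<lambda>(k,\<beta>). G k \<beta>) x)) summable_on (UNIV \<times> M)"
    proof (rule summable_on_comparison_test[OF S])
      fix x :: "nat \<times> ('a \<Rightarrow> nat)"
      obtain k \<beta> where x: "x = (k, \<beta>)" by (cases x)
      have "\<bar>G k \<beta>\<bar> = \<bar>C (Suc k) \<beta> * \<rho> ^ k\<bar> * \<bar>real (Suc k) * (t / \<rho>) ^ k\<bar>"
        using \<rho> by (simp add: G_def abs_mult power_divide)
      also have "\<dots> \<le> \<bar>C (Suc k) \<beta> * \<rho> ^ k\<bar> * B"
        by (intro mult_left_mono B) auto
      also have "\<dots> = \<bar>C (Suc k) \<beta> * \<rho> ^ Suc k\<bar> * (B / \<rho>)"
        using \<rho> by (simp add: abs_mult)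
      finally show "norm ((\<lambda>(k,\<beta>). G k \<beta>) x) \<le> norm ((\<lambda>(k,\<beta>). C (Suc k) \<beta> * \<rho> ^ Suc k) x) * (B / \<rho>)"
        by (simp add: x)
    qed auto
    then show ?thesis by (rule summable_on_iff_abs_summable_on_real[THEN iffD2])
  qed
  then obtain D where D: "((\<lambda>(k,\<beta>). G k \<beta>) has_sum D) (UNIV \<times> M)" by (auto simp: summable_on_def)
  have "((\<lambda>k. diffs A k * t ^ k) has_sum D) UNIV"
  proof (rule has_sum_SigmaD[OF D])
    fix k
    have "((\<lambda>\<beta>. real (Suc k) * C (Suc k) \<beta> * t ^ k) has_sum (real (Suc k) * A (Suc k) * t ^ k)) M"
      by (intro has_sum_cmult_left has_sum_cmult_right hsC)
    then show "((\<lambda>\<beta>. case (k, \<beta>) of (k, \<beta>) \<Rightarrow> G k \<beta>) has_sum diffs A k * t ^ k) M"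
      by (simp add: G_def diffs_def)
  qed
  then have "?D = D" by (rule sums_unique[OF has_sum_imp_sums, symmetric])
  with D have D': "((\<lambda>(k,\<beta>). G k \<beta>) has_sum ?D) (UNIV \<times> M)" by simp
  have "((\<lambda>\<alpha>. (real (Suc (\<alpha> b)) * c (\<alpha>(b := Suc (\<alpha> b)))) * monomial \<alpha> (z - p)) has_sum ?D) multi_indices"
    unfolding has_sum_multi_indices_split[OF b] M_def[symmetric]
    by (rule has_sum_cong[THEN iffD1, OF _ D'])
       (auto simp: M_def G_def C_def zp monomial_upd_shift[OF b] wb)
  with der show ?thesis by blast
qed

lemma real_analytic_has_partial:
  assumes "b \<in> Basis" "real_analytic f"
  shows "((\<lambda>s. f (z + s *\<^sub>R b)) has_field_derivative partial b f z) (at 0)"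
proof -
  obtain r c where 1: "r > 0" "\<forall>x\<in>ball z r. ((\<lambda>\<alpha>. c \<alpha> * monomial \<alpha> (x - z)) has_sum f x) multi_indices"
    using assms(2) unfolding real_analytic_def by blast
  obtain D where "((\<lambda>s. f (z + s *\<^sub>R b)) has_field_derivative D) (at 0)"
    using power_series_partial[OF assms(1) 1(1), of z c f z] 1 by auto
  then show ?thesis unfolding partial_def using DERIV_imp_deriv by metis
qed

lemma real_analytic_partial:
  assumes b: "b \<in> Basis" and f: "real_analytic f"
  shows "real_analytic (partial b f)"
  unfolding real_analytic_def
proof
  fix p
  obtain r c where 1: "r > 0" "\<forall>z\<in>ball p r. ((\<lambda>\<alpha>. c \<alpha> * monomial \<alpha> (z - p)) has_sum f z) multi_indices"
    using f unfolding real_analytic_def by blast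
  show "\<exists>r>0. \<exists>c. \<forall>z\<in>ball p r. ((\<lambda>\<alpha>. c \<alpha> * monomial \<alpha> (z - p)) has_sum partial b f z) multi_indices"
  proof (intro exI conjI ballI)
    show "r > 0" by fact
    fix z assume z: "z \<in> ball p r"
    obtain D where D: "((\<lambda>s. f (z + s *\<^sub>R b)) has_field_derivative D) (at 0)"
      "((\<lambda>\<alpha>. (real (Suc (\<alpha> b)) * c (\<alpha>(b := Suc (\<alpha> b)))) * monomial \<alpha> (z - p)) has_sum D) multi_indices"
      using power_series_partial[OF b 1(1), of p c f z] 1 z by auto
    have "partial b f z = D" using D(1) unfolding partial_def by (rule DERIV_imp_deriv)
    then show "((\<lambda>\<alpha>. (real (Suc (\<alpha> b)) * c (\<alpha>(b := Suc (\<alpha> b)))) * monomial \<alpha> (z - p)) has_sum partial b f z) multi_indices"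
      using D(2) by simp
  qed
qed

lemma partial_add:
  assumes "b \<in> Basis" "real_analytic f" "real_analytic g"
  shows "partial b (\<lambda>z. f z + g z) z = partial b f z + partial b g z"
  unfolding partial_def[of b "\<lambda>z. f z + g z"]
  by (intro DERIV_imp_deriv DERIV_add real_analytic_has_partial assms)

lemma partial_mult:
  assumes "b \<in> Basis" "real_analytic f" "real_analytic g"
  shows "partial b (\<lambda>z. f z * g z) z = partial b f z * g z + f z * partial b g z"
  unfolding partial_def[of b "\<lambda>z. f z * g z"]
  using DERIV_mult[OF real_analytic_has_partial[OF assms(1,2), of z] real_analytic_has_partial[OF assms(1,3), of z]]
  by (intro DERIV_imp_deriv) (simp add: mult.commute)

typedef (overloaded) 'a analytic_fun = "{f :: 'a::euclidean_space \<Rightarrow> real. real_analytic f}"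
  using real_analytic_const by blast

setup_lifting type_definition_analytic_fun

text \<open>Adjoining \<open>j\<close> with \<open>j\<^sup>2 = -1\<close> to a field gives a field only if \<open>-1\<close> is not a square there,
  which for meromorphic functions follows from the next property.\<close>

class formally_real_idom = idom +
  assumes sum_squares_eq_0: "x * x + y * y = 0 \<Longrightarrow> x = 0"

instantiation analytic_fun :: (euclidean_space) formally_real_idom
begin

lift_definition zero_analytic_fun :: "'a analytic_fun" is "\<lambda>_. 0" by (rule real_analytic_const)
lift_definition one_analytic_fun :: "'a analytic_fun" is "\<lambda>_. 1" by (rule real_analytic_const)
lift_definition plus_analytic_fun :: "'a analytic_fun \<Rightarrow> 'a analytic_fun \<Rightarrow> 'a analytic_fun"
  is "\<lambda>f g z. f z + g z" by (rule real_analytic_add)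
lift_definition times_analytic_fun :: "'a analytic_fun \<Rightarrow> 'a analytic_fun \<Rightarrow> 'a analytic_fun"
  is "\<lambda>f g z. f z * g z" by (rule real_analytic_mult)
lift_definition uminus_analytic_fun :: "'a analytic_fun \<Rightarrow> 'a analytic_fun"
  is "\<lambda>f z. - f z" using real_analytic_mult[OF real_analytic_const[of "-1"]] by simp
lift_definition minus_analytic_fun :: "'a analytic_fun \<Rightarrow> 'a analytic_fun \<Rightarrow> 'a analytic_fun"
  is "\<lambda>f g z. f z - g z"
  using real_analytic_add[OF _ real_analytic_mult[OF real_analytic_const[of "-1"]]] by force

instance
proof
  fix f g :: "'a analytic_fun"
  assume "f \<noteq> 0" "g \<noteq> 0"
  then show "f * g \<noteq> 0"
    by transfer (metis real_analytic_mult_eq_0)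
next
  fix f g :: "'a analytic_fun"
  assume "f * f + g * g = 0"
  then show "f = 0"
    by transfer (metis sum_squares_eq_zero_iff)
qed (transfer; simp add: algebra_simps fun_eq_iff)+

end

instance fract :: (formally_real_idom) formally_real_idom
proof
  fix x y :: "'a fract"
  assume eq: "x * x + y * y = 0"
  obtain a b where x: "x = Fract a b" "b \<noteq> 0" by (cases x)
  obtain c d where y: "y = Fract c d" "d \<noteq> 0" by (cases y)
  have "(a * a) * (d * d) + (c * c) * (b * b) = 0"
    using eq x y by (simp add: Zero_fract_def eq_fract)
  then have "(a * d) * (a * d) + (c * b) * (c * b) = 0" by (simp add: ac_simps)
  then have "a * d = 0" by (rule sum_squares_eq_0)
  then show "x = 0" using x y by (simp add: Zero_fract_def eq_fract)
qed

text \<open>\<open>AdjoinJ a b\<close> stands for \<open>a + b j\<close>.\<close>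

datatype 'a adjoin_j = AdjoinJ (real_part: 'a) (imag_part: 'a)

lemma adjoin_j_eq_iff: "x = y \<longleftrightarrow> real_part x = real_part y \<and> imag_part x = imag_part y"
  by (cases x; cases y) auto

class formally_real_field = field + formally_real_idom

instance fract :: (formally_real_idom) formally_real_field ..

instantiation adjoin_j :: (formally_real_field) field
begin

definition "0 = AdjoinJ 0 0"
definition "1 = AdjoinJ 1 0"
definition "x + y = AdjoinJ (real_part x + real_part y) (imag_part x + imag_part y)"
definition "- x = AdjoinJ (- real_part x) (- imag_part x)"
definition "x - y = AdjoinJ (real_part x - real_part y) (imag_part x - imag_part y)"
definition "x * y = AdjoinJ (real_part x * real_part y - imag_part x * imag_part y)
                            (real_part x * imag_part y + imag_part x * real_part y)"
definition "inverse x =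
  (let N = real_part x * real_part x + imag_part x * imag_part x
   in AdjoinJ (real_part x / N) (- imag_part x / N))"
definition "x div y = x * inverse (y :: 'a adjoin_j)"

lemmas adjoin_j_defs = zero_adjoin_j_def one_adjoin_j_def plus_adjoin_j_def uminus_adjoin_j_def
  minus_adjoin_j_def times_adjoin_j_def

instance
proof
  fix x :: "'a adjoin_j"
  assume "x \<noteq> 0"
  define N where "N = real_part x * real_part x + imag_part x * imag_part x"
  have "N \<noteq> 0"
  proof
    assume N: "N = 0"
    then have "imag_part x * imag_part x + real_part x * real_part x = 0" by (simp add: N_def add.commute)
    with N have "real_part x = 0" "imag_part x = 0"
      unfolding N_def using sum_squares_eq_0 by blast+
    with \<open>x \<noteq> 0\<close> show False by (simp add: adjoin_j_eq_iff zero_adjoin_j_def)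
  qed
  have "real_part x / N * real_part x - - imag_part x / N * imag_part x = (real_part x * real_part x + imag_part x * imag_part x) / N"
    by (simp add: add_divide_distrib)
  then have "real_part x / N * real_part x - - imag_part x / N * imag_part x = N / N"
    by (simp add: N_def)
  then show "inverse x * x = 1"
    using \<open>N \<noteq> 0\<close> by (simp add: inverse_adjoin_j_def times_adjoin_j_def one_adjoin_j_def N_def[symmetric])
qed (simp_all add: adjoin_j_defs divide_adjoin_j_def inverse_adjoin_j_def algebra_simps adjoin_j_eq_iff)

end

lemma Basis_space_time:
  "(axis i 1, 0) \<in> (Basis :: ((real ^ 'n) \<times> real) set)"
  "(0, 1) \<in> (Basis :: ((real ^ 'n) \<times> real) set)"
  by (auto simp: Basis_prod_def axis_in_Basis_iff)

text \<open>Real analytic functions of \<open>(x, t)\<close>, their fraction field \<open>K\<^sub>\<real>\<close>, and \<open>K = K\<^sub>\<real> + K\<^sub>\<real> j\<close>.\<close>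

type_synonym 'n analytic_xt = "((real ^ 'n) \<times> real) analytic_fun"
type_synonym 'n mero_real = "'n analytic_xt fract"
type_synonym 'n mero = "'n mero_real adjoin_j"

lift_definition analytic_partial_x :: "'n::finite \<Rightarrow> 'n analytic_xt \<Rightarrow> 'n analytic_xt"
  is "\<lambda>i. partial (axis i 1, 0)"
  by (intro real_analytic_partial Basis_space_time)

lift_definition analytic_partial_t :: "'n::finite analytic_xt \<Rightarrow> 'n analytic_xt"
  is "partial (0, 1)"
  by (intro real_analytic_partial Basis_space_time)

lemma analytic_partial_x_add: "analytic_partial_x i (f + g) = analytic_partial_x i f + analytic_partial_x i g"
  by transfer (simp add: fun_eq_iff partial_add Basis_space_time)

lemma analytic_partial_t_add: "analytic_partial_t (f + g) = analytic_partial_t f + analytic_partial_t g"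
  by transfer (simp add: fun_eq_iff partial_add Basis_space_time)

lemma analytic_partial_x_mult:
  "analytic_partial_x i (f * g) = analytic_partial_x i f * g + f * analytic_partial_x i g"
  by transfer (simp add: fun_eq_iff partial_mult Basis_space_time)

lemma analytic_partial_t_mult:
  "analytic_partial_t (f * g) = analytic_partial_t f * g + f * analytic_partial_t g"
  by transfer (simp add: fun_eq_iff partial_mult Basis_space_time)

text \<open>Well defined when \<open>D\<close> satisfies the Leibniz rule; see the next lemma.\<close>

definition fract_derivation :: "('a::idom \<Rightarrow> 'a) \<Rightarrow> 'a fract \<Rightarrow> 'a fract" where
  "fract_derivation D q =
    (THE r. \<forall>a b. b \<noteq> 0 \<and> q = Fract a b \<longrightarrow> r = Fract (D a * b - a * D b) (b * b))"

lemma fract_derivation_Fract: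
  fixes D :: "'a::idom \<Rightarrow> 'a"
  assumes mult: "\<And>x y. D (x * y) = D x * y + x * D y" and b: "b \<noteq> 0"
  shows "fract_derivation D (Fract a b) = Fract (D a * b - a * D b) (b * b)"
proof -
  have "Fract (D a * b - a * D b) (b * b) = Fract (D c * d - c * D d) (d * d)"
    if d: "d \<noteq> 0" and "Fract a b = Fract c d" for c d
  proof -
    have eq: "a * d = c * b" using that b by (simp add: eq_fract)
    have D: "D a * d + a * D d = D c * b + c * D b"
      using mult[of a d] mult[of c b] eq by simp
    have "(D a * b - a * D b) * (d * d) =
        b * d * (D a * d + a * D d) - b * D d * (a * d) - d * D b * (a * d)"
      by (simp add: algebra_simps)
    also have "\<dots> = b * d * (D c * b + c * D b) - b * D d * (c * b) - d * D b * (c * b)"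
      by (simp only: D eq)
    also have "\<dots> = (D c * d - c * D d) * (b * b)"
      by (simp add: algebra_simps)
    finally have "(D a * b - a * D b) * (d * d) = (D c * d - c * D d) * (b * b)" .
    then show ?thesis using b d by (simp add: eq_fract)
  qed
  then show ?thesis
    unfolding fract_derivation_def using b by (intro the_equality) blast+
qed

lemma fract_derivation_add_mult:
  fixes D :: "'a::idom \<Rightarrow> 'a"
  assumes add: "\<And>x y. D (x + y) = D x + D y" and mult: "\<And>x y. D (x * y) = D x * y + x * D y"
  shows "fract_derivation D (p + q) = fract_derivation D p + fract_derivation D q"
    and "fract_derivation D (p * q) = fract_derivation D p * q + p * fract_derivation D q"
proof -
  let ?D = "fract_derivation D"
  note D' = fract_derivation_Fract[of D, OF mult]
  obtain a b where p: "p = Fract a b" "b \<noteq> 0" by (cases p)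
  obtain c d where q: "q = Fract c d" "d \<noteq> 0" by (cases q)
  have nz: "b * d \<noteq> 0" "b * b \<noteq> 0" "d * d \<noteq> 0" "b * b * d \<noteq> 0" "b * (d * d) \<noteq> 0" "b * b * (d * d) \<noteq> 0"
    "b * d * (b * d) \<noteq> 0" "b * b * d * (b * (d * d)) \<noteq> 0"
    using p q by auto
  have "(D a * d + a * D d + (D c * b + c * D b)) * (b * d) - (a * d + c * b) * (D b * d + b * D d) =
    (D a * b - a * D b) * (d * d) + (D c * d - c * D d) * (b * b)"
    by (simp add: algebra_simps)
  moreover have "b * b * (d * d) = b * d * (b * d)" by (simp add: ac_simps)
  ultimately have "((D a * d + a * D d + (D c * b + c * D b)) * (b * d) - (a * d + c * b) * (D b * d + b * D d)) * (b * b * (d * d)) =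
    ((D a * b - a * D b) * (d * d) + (D c * d - c * D d) * (b * b)) * (b * d * (b * d))"
    by (simp only:)
  then show "?D (p + q) = ?D p + ?D q"
    unfolding p(1) q(1) add_fract[OF p(2) q(2)] D'[OF p(2)] D'[OF q(2)] D'[OF nz(1)]
      add_fract[OF nz(2,3)] eq_fract(1)[OF nz(7,6)] add mult .
  define E where "E = (D a * c + a * D c) * (b * d) - a * c * (D b * d + b * D d)"
  have "E * (b * d) = (D a * b - a * D b) * c * (b * (d * d)) + a * (D c * d - c * D d) * (b * b * d)"
    by (simp add: E_def algebra_simps)
  moreover have "E * (b * b * d * (b * (d * d))) = E * (b * d) * (b * d * (b * d))" by (simp add: ac_simps)
  ultimately have "((D a * c + a * D c) * (b * d) - a * c * (D b * d + b * D d)) * (b * b * d * (b * (d * d))) =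
    ((D a * b - a * D b) * c * (b * (d * d)) + a * (D c * d - c * D d) * (b * b * d)) * (b * d * (b * d))"
    by (simp only: E_def)
  then show "?D (p * q) = ?D p * q + p * ?D q"
    unfolding p(1) q(1) mult_fract D'[OF p(2)] D'[OF q(2)] D'[OF nz(1)]
      add_fract[OF nz(4,5)] eq_fract(1)[OF nz(7,8)] mult .
qed


definition mero_real_partial_x :: "'n::finite \<Rightarrow> 'n mero_real \<Rightarrow> 'n mero_real" where
  "mero_real_partial_x i = fract_derivation (analytic_partial_x i)"

definition mero_real_partial_t :: "'n::finite mero_real \<Rightarrow> 'n mero_real" where
  "mero_real_partial_t = fract_derivation analytic_partial_t"

lemma mero_real_partial_add_mult:
  "mero_real_partial_x i (p + q) = mero_real_partial_x i p + mero_real_partial_x i q"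
  "mero_real_partial_x i (p * q) = mero_real_partial_x i p * q + p * mero_real_partial_x i q"
  "mero_real_partial_t (p + q) = mero_real_partial_t p + mero_real_partial_t q"
  "mero_real_partial_t (p * q) = mero_real_partial_t p * q + p * mero_real_partial_t q"
  unfolding mero_real_partial_x_def mero_real_partial_t_def
  by (intro fract_derivation_add_mult analytic_partial_x_add analytic_partial_x_mult
      analytic_partial_t_add analytic_partial_t_mult)+

definition mero_partial_x :: "'n::finite \<Rightarrow> 'n mero \<Rightarrow> 'n mero" where
  "mero_partial_x i a = AdjoinJ (mero_real_partial_x i (real_part a)) (mero_real_partial_x i (imag_part a))"

definition mero_partial_t :: "'n::finite mero \<Rightarrow> 'n mero" where
  "mero_partial_t a = AdjoinJ (mero_real_partial_t (real_part a)) (mero_real_partial_t (imag_part a))"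

definition of_analytic :: "'n::finite analytic_xt \<Rightarrow> 'n mero" where
  "of_analytic a = AdjoinJ (Fract a 1) 0"

definition delta :: "'n::finite analytic_xt ^ 'n \<Rightarrow> 'n mero \<Rightarrow> 'n mero" where
  "delta f a = mero_partial_t a + (\<Sum>i\<in>UNIV. mero_partial_x i a * of_analytic (f $ i))"

lemma mero_partial_x_add: "mero_partial_x i (a + b) = mero_partial_x i a + mero_partial_x i b"
  by (simp add: mero_partial_x_def plus_adjoin_j_def mero_real_partial_add_mult)

lemma mero_partial_t_add: "mero_partial_t (a + b) = mero_partial_t a + mero_partial_t b"
  by (simp add: mero_partial_t_def plus_adjoin_j_def mero_real_partial_add_mult)

lemma additive_diff:
  fixes D :: "'a::ab_group_add \<Rightarrow> 'b::ab_group_add"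
  assumes "\<And>x y. D (x + y) = D x + D y"
  shows "D (x - y) = D x - D y"
  using assms[of "x - y" y] by (simp add: algebra_simps)

lemma mero_partial_x_mult: "mero_partial_x i (a * b) = mero_partial_x i a * b + a * mero_partial_x i b"
  by (simp add: mero_partial_x_def plus_adjoin_j_def times_adjoin_j_def mero_real_partial_add_mult
      additive_diff[of "mero_real_partial_x i", OF mero_real_partial_add_mult(1)] algebra_simps)

lemma mero_partial_t_mult: "mero_partial_t (a * b) = mero_partial_t a * b + a * mero_partial_t b"
  by (simp add: mero_partial_t_def plus_adjoin_j_def times_adjoin_j_def mero_real_partial_add_mult
      additive_diff[of mero_real_partial_t, OF mero_real_partial_add_mult(3)] algebra_simps)

lemma delta_add: "delta f (a + b) = delta f a + delta f b"
  by (simp add: delta_def mero_partial_t_add mero_partial_x_add distrib_right sum.distrib)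

lemma delta_mult: "delta f (a * b) = delta f a * b + a * delta f b"
proof -
  have "(\<Sum>i\<in>UNIV. mero_partial_x i (a * b) * of_analytic (f $ i)) =
    (\<Sum>i\<in>UNIV. mero_partial_x i a * of_analytic (f $ i) * b + a * (mero_partial_x i b * of_analytic (f $ i)))"
    by (intro sum.cong refl) (simp add: mero_partial_x_mult algebra_simps)
  then show ?thesis
    by (simp add: delta_def mero_partial_t_mult distrib_right distrib_left sum.distrib
        sum_distrib_left sum_distrib_right)
qed

definition delta_vec :: "'n::finite analytic_xt ^ 'n \<Rightarrow> 'n mero ^ 'm \<Rightarrow> 'n mero ^ 'm" where
  "delta_vec f w = (\<chi> i. delta f (w $ i))"

definition delta_mat :: "'n::finite analytic_xt ^ 'n \<Rightarrow> 'n mero ^ 'm ^ 'k \<Rightarrow> 'n mero ^ 'm ^ 'k" where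
  "delta_mat f X = map_matrix (delta f) X"

definition of_analytic_mat :: "'n::finite analytic_xt ^ 'm ^ 'k \<Rightarrow> 'n mero ^ 'm ^ 'k" where
  "of_analytic_mat A = map_matrix of_analytic A"

definition rspec :: "'n::finite analytic_xt ^ 'n \<Rightarrow> 'n mero ^ 'm ^ 'm \<Rightarrow> 'n mero set" where
  "rspec f M = {\<beta>. \<exists>w. w \<noteq> 0 \<and> M *v w - delta_vec f w = \<beta> *s w}"

definition right_invariant ::
  "'n::finite analytic_xt ^ 'n \<Rightarrow> 'n mero ^ 'm ^ 'm \<Rightarrow> ('n mero ^ 'm) set \<Rightarrow> bool" where
  "right_invariant f M W \<longleftrightarrow> (\<forall>w\<in>W. M *v w - delta_vec f w \<in> W)"

definition rspec_on ::
  "'n::finite analytic_xt ^ 'n \<Rightarrow> 'n mero ^ 'm ^ 'm \<Rightarrow> ('n mero ^ 'm) set \<Rightarrow> 'n mero set" where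
  "rspec_on f M W = {\<beta>. \<exists>w\<in>W. w \<noteq> 0 \<and> M *v w - delta_vec f w = \<beta> *s w}"

definition regular :: "'a::field ^ 'n ^ 'n \<Rightarrow> bool" where
  "regular M \<longleftrightarrow> rank M = CARD('n)"

lemma regular_iff_invertible: "regular M \<longleftrightarrow> invertible M"
proof -
  have "rank M = CARD('b) \<longleftrightarrow> vec.span (rows M) = UNIV"
    unfolding row_rank_def_gen
    using vec.dim_eq_full[of "rows M"] vec_dim_card by (simp add: vec.dimension_def card_cart_basis)
  then show ?thesis
    by (simp add: regular_def invertible_left_inverse matrix_left_invertible_span_rows_gen)
qed

definition block_matrix ::
  "'a ^ 'n ^ 'n \<Rightarrow> 'a ^ 'n ^ 'n \<Rightarrow> 'a ^ 'n ^ 'n \<Rightarrow> 'a ^ 'n ^ 'n \<Rightarrow> 'a ^ ('n + 'n) ^ ('n + 'n)" where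
  "block_matrix A B C D = (\<chi> i j. case (i, j) of
      (Inl k, Inl l) \<Rightarrow> A $ k $ l | (Inl k, Inr l) \<Rightarrow> B $ k $ l
    | (Inr k, Inl l) \<Rightarrow> C $ k $ l | (Inr k, Inr l) \<Rightarrow> D $ k $ l)"

definition stack_matrix :: "'a ^ 'n ^ 'n \<Rightarrow> 'a ^ 'n ^ 'n \<Rightarrow> 'a ^ 'n ^ ('n + 'n)" where
  "stack_matrix U V = (\<chi> i j. case i of Inl k \<Rightarrow> U $ k $ j | Inr k \<Rightarrow> V $ k $ j)"

definition image_matrix :: "'a::field ^ 'n ^ 'm \<Rightarrow> ('a ^ 'm) set" where
  "image_matrix M = vec.span (columns M)"

definition hamiltonian :: 
  "'n::finite analytic_xt ^ 'n ^ 'n \<Rightarrow> 'n analytic_xt ^ 'n ^ 'n \<Rightarrow> 'n analytic_xt ^ 'n ^ 'n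
    \<Rightarrow> 'n mero ^ ('n + 'n) ^ ('n + 'n)" where
  "hamiltonian A R Q =
    of_analytic_mat (block_matrix A (- R) (- Q) (- transpose A))"

definition riccati_solution ::
  "'n::finite analytic_xt ^ 'n \<Rightarrow> 'n analytic_xt ^ 'n ^ 'n \<Rightarrow> 'n analytic_xt ^ 'n ^ 'n
    \<Rightarrow> 'n analytic_xt ^ 'n ^ 'n \<Rightarrow> 'n mero ^ 'n ^ 'n \<Rightarrow> bool" where
  "riccati_solution f A R Q X \<longleftrightarrow>
    delta_mat f X + X ** of_analytic_mat A + transpose (of_analytic_mat A) ** X
      - X ** of_analytic_mat R ** X = - of_analytic_mat Q"

end

theory Submission
  imports Defs
begin

text \<open>If \<open>U\<close> is regular, the column span of \<open>[U; V]\<close> is the graph \<open>{[y; X y]}\<close> of \<open>X = V U\<^sup>-\<^sup>1\<close>. For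
  \<open>w = [y; X y]\<close> the upper block of \<open>\<H> w - \<delta>(w)\<close> is \<open>u = (A - R X) y - \<delta>(y)\<close>, and its lower block is
  \<open>X u\<close> minus the residual of the Riccati equation applied to \<open>y\<close>. So the graph is invariant exactly
  when \<open>X\<close> solves the equation, and then \<open>y \<mapsto> [y; X y]\<close> intertwines the operators of \<open>A - R X\<close> and
  \<open>\<H>\<close>.\<close>

section \<open>Block vectors and block matrices\<close>

definition stack_vector :: "'a ^ 'n \<Rightarrow> 'a ^ 'n \<Rightarrow> 'a ^ ('n + 'n)" where
  "stack_vector y z = (\<chi> i. case i of Inl k \<Rightarrow> y $ k | Inr k \<Rightarrow> z $ k)"

lemma stack_vector_nth [simp]:
  "stack_vector y z $ Inl k = y $ k" "stack_vector y z $ Inr k = z $ k"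
  by (simp_all add: stack_vector_def)

lemma vec_sum_eq_iff:
  fixes v w :: "'a ^ ('n::finite + 'm::finite)"
  shows "v = w \<longleftrightarrow> (\<forall>k. v $ Inl k = w $ Inl k) \<and> (\<forall>k. v $ Inr k = w $ Inr k)"
  by (metis vec_eq_iff sum.exhaust)

lemma stack_vector_eq_iff [simp]: "stack_vector y z = stack_vector y' z' \<longleftrightarrow> y = y' \<and> z = z'"
  unfolding vec_sum_eq_iff by (simp add: vec_eq_iff)

lemma stack_vector_diff: "stack_vector y z - stack_vector y' z' = stack_vector (y - y') (z - z')"
  by (simp add: vec_sum_eq_iff)

lemma stack_vector_smult: "\<beta> *s stack_vector y z = stack_vector (\<beta> *s y) (\<beta> *s z)"
  by (simp add: vec_sum_eq_iff)

lemma stack_vector_eq_0_iff: "stack_vector y z = 0 \<longleftrightarrow> y = 0 \<and> z = 0"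
  unfolding vec_sum_eq_iff by (simp add: vec_eq_iff)

lemma stack_matrix_mult: "stack_matrix U V *v y = stack_vector (U *v y) (V *v y)"
  by (simp add: vec_sum_eq_iff stack_matrix_def matrix_vector_mult_def)

lemma block_matrix_mult:
  fixes A B C D :: "'a::semiring_1 ^ 'n::finite ^ 'n"
  shows "block_matrix A B C D *v stack_vector y z = stack_vector (A *v y + B *v z) (C *v y + D *v z)"
proof -
  have "(\<Sum>i\<in>UNIV. h i) = (\<Sum>k\<in>UNIV. h (Inl k)) + (\<Sum>k\<in>UNIV. h (Inr k))" for h :: "'n + 'n \<Rightarrow> 'a"
    unfolding UNIV_Plus_UNIV[symmetric] by (subst sum.Plus) auto
  then show ?thesis
    by (simp add: vec_sum_eq_iff block_matrix_def matrix_vector_mult_def)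
qed

lemma minus_matrix_vector_mult: "(- M) *v y = - (M *v y)" for M :: "'a::ring_1 ^ 'n ^ 'm"
  by (simp add: vec_eq_iff matrix_vector_mult_def sum_negf)

section \<open>Column spans and graphs of matrices\<close>

lemma image_matrix_eq_range: "image_matrix M = range ((*v) M)" for M :: "'a::field ^ 'n ^ 'm"
proof
  have "columns M \<subseteq> range ((*v) M)"
  proof
    fix c assume "c \<in> columns M"
    then obtain i where "c = column i M" by (auto simp: columns_def)
    \<comment> \<open>Multiplying by a unit vector picks out one column, so the range of
      \<open>M\<close> contains the columns and, being a subspace, their span.\<close>
    then have "c = M *v axis i 1"
      by (simp add: vec_eq_iff matrix_vector_mult_def column_def axis_def if_distrib cong: if_cong)
    then show "c \<in> range ((*v) M)" by blast
  qed
  then show "image_matrix M \<subseteq> range ((*v) M)"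
    unfolding image_matrix_def by (intro vec.span_minimal vec.subspace_image vec.subspace_UNIV)
  show "range ((*v) M) \<subseteq> image_matrix M"
    unfolding image_matrix_def by (auto intro: matrix_vector_mult_in_columnspace_gen)
qed

text \<open>This set depends on \<open>X\<close> alone, so all pairs \<open>U\<close>,
  \<open>V\<close> with \<open>V ** matrix_inv U = X\<close> can be treated together.\<close>

definition matrix_graph :: "'a::field ^ 'n ^ 'n \<Rightarrow> ('a ^ ('n + 'n)) set" where
  "matrix_graph X = range (\<lambda>y. stack_vector y (X *v y))"

lemma stack_vector_in_matrix_graph_iff: "stack_vector y z \<in> matrix_graph X \<longleftrightarrow> z = X *v y"
  by (auto simp: matrix_graph_def)

text \<open>\<open>matrix_inv\<close> is defined by choice; regularity supplies the two-sided
  inverse that makes the chosen matrix meaningful.\<close>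

lemma matrix_inv_mult:
  fixes U :: "'a::field ^ 'n ^ 'n"
  assumes "regular U"
  shows "U ** matrix_inv U = mat 1" "matrix_inv U ** U = mat 1"
  using assms someI_ex[of "\<lambda>B. U ** B = mat 1 \<and> B ** U = mat 1"]
  unfolding regular_iff_invertible invertible_def matrix_inv_def by blast+

lemma regular_mat_1: "regular (mat 1 :: 'a::field ^ 'n ^ 'n)"
  unfolding regular_iff_invertible invertible_def by (intro exI[of _ "mat 1"]) simp

lemma matrix_inv_mat_1: "matrix_inv (mat 1 :: 'a::field ^ 'n ^ 'n) = mat 1"
  using matrix_inv_mult(1)[OF regular_mat_1] by simp

text \<open>Substituting \<open>U *v y\<close> for the parameter of the graph gives one inclusion.
  As \<open>U\<close> is invertible, every vector has this form, which gives the other.\<close>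

lemma image_stack_matrix_eq_graph:
  fixes U V :: "'a::field ^ 'n::finite ^ 'n"
  assumes "regular U"
  shows "image_matrix (stack_matrix U V) = matrix_graph (V ** matrix_inv U)"
proof -
  note inv = matrix_inv_mult[OF assms]
  have "stack_vector (U *v y) (V *v y) = stack_vector (U *v y) ((V ** matrix_inv U) *v (U *v y))" for y
    by (simp add: matrix_vector_mul_assoc matrix_mul_assoc[symmetric] inv)
  moreover have "stack_vector y ((V ** matrix_inv U) *v y)
      = stack_vector (U *v (matrix_inv U *v y)) (V *v (matrix_inv U *v y))" for y
    by (simp add: matrix_vector_mul_assoc inv)
  ultimately show ?thesis
    unfolding image_matrix_eq_range matrix_graph_def stack_matrix_mult
    by (metis (no_types, lifting) image_subset_iff rangeI subset_antisym)
qed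

text \<open>The graph is the image of \<open>[I; X]\<close>, which is injective because the upper
  block of the result is the argument itself.\<close>

lemma matrix_graph_subspace_dim:
  fixes X :: "'a::field ^ 'n::finite ^ 'n"
  shows "vec.subspace (matrix_graph X)" "vec.dim (matrix_graph X) = CARD('n)"
proof -
  have G: "matrix_graph X = range ((*v) (stack_matrix (mat 1) X))"
    by (simp add: matrix_graph_def stack_matrix_mult)
  show "vec.subspace (matrix_graph X)"
    unfolding G by (intro vec.subspace_image vec.subspace_UNIV)
  have "inj ((*v) (stack_matrix (mat 1) X))"
    by (rule injI) (simp add: stack_matrix_mult)
  then show "vec.dim (matrix_graph X) = CARD('n)"
    unfolding G by (subst vec.dim_image_eq) (auto simp: vec_dim_card card_cart_basis intro: inj_on_subset)
qed

section \<open>The derivation on vectors\<close>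

lemma delta_0: "delta f 0 = 0"
  using delta_add[of f 0 0] by (metis add.right_neutral add_left_cancel)

lemma delta_sum: "delta f (sum h S) = (\<Sum>i\<in>S. delta f (h i))"
  by (induction S rule: infinite_finite_induct) (simp_all add: delta_0 delta_add)

lemma delta_vec_stack_vector:
  "delta_vec f (stack_vector y z) = stack_vector (delta_vec f y) (delta_vec f z)"
  by (simp add: vec_sum_eq_iff delta_vec_def)

text \<open>The product rule for \<open>delta\<close>, summed along each row. It is the source of
  the term \<delta>(X) in the Riccati equation.\<close>

lemma delta_vec_matrix_vector_mult:
  "delta_vec f (X *v y) = delta_mat f X *v y + X *v delta_vec f y"
  by (simp add: vec_eq_iff delta_vec_def delta_mat_def map_matrix_def matrix_vector_mult_def
      delta_sum delta_mult sum.distrib)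

lemma of_analytic_uminus: "of_analytic (- a) = - of_analytic a"
  by (simp add: of_analytic_def uminus_adjoin_j_def)

section \<open>The Hamiltonian matrix, the Riccati equation and graphs\<close>

lemma hamiltonian_eq_block_matrix:
  "hamiltonian A R Q = block_matrix (of_analytic_mat A) (- of_analytic_mat R)
     (- of_analytic_mat Q) (- transpose (of_analytic_mat A))"
  by (simp add: vec_eq_iff hamiltonian_def of_analytic_mat_def map_matrix_def block_matrix_def
      transpose_def of_analytic_uminus split: sum.splits)

text \<open>Left side minus right side of the Riccati equation, kept as a matrix in order to measure
  how far the graph of an arbitrary \<open>X\<close> is from being invariant.\<close>

definition riccati_residual ::
  "'n::finite analytic_xt ^ 'n \<Rightarrow> 'n analytic_xt ^ 'n ^ 'n \<Rightarrow> 'n analytic_xt ^ 'n ^ 'n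
    \<Rightarrow> 'n analytic_xt ^ 'n ^ 'n \<Rightarrow> 'n mero ^ 'n ^ 'n \<Rightarrow> 'n mero ^ 'n ^ 'n" where
  "riccati_residual f A R Q X =
    delta_mat f X + X ** of_analytic_mat A + transpose (of_analytic_mat A) ** X
      - X ** of_analytic_mat R ** X + of_analytic_mat Q"

lemma riccati_solution_iff_residual: "riccati_solution f A R Q X \<longleftrightarrow> riccati_residual f A R Q X = 0"
  unfolding riccati_solution_def riccati_residual_def by (simp add: eq_neg_iff_add_eq_0)

text \<open>The lower block is directly -Q y - A^T X y - \<delta>(X) y - X \<delta>(y). The terms X
  A y and X R X y, absent here, occur both in X u and in the residual applied to y, and cancel in
  the difference.\<close>

lemma hamiltonian_on_graph:
  fixes f :: "'n::finite analytic_xt ^ 'n" and A R Q :: "'n analytic_xt ^ 'n ^ 'n"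
    and X :: "'n mero ^ 'n ^ 'n"
  defines "u \<equiv> \<lambda>y. (of_analytic_mat A - of_analytic_mat R ** X) *v y - delta_vec f y"
  shows "hamiltonian A R Q *v stack_vector y (X *v y) - delta_vec f (stack_vector y (X *v y))
    = stack_vector (u y) (X *v u y - riccati_residual f A R Q X *v y)"
  unfolding u_def riccati_residual_def hamiltonian_eq_block_matrix block_matrix_mult
    delta_vec_stack_vector stack_vector_diff delta_vec_matrix_vector_mult
  \<comment> \<open>Matrix products are split into successive applications to \<open>y\<close>, so
    that only sums of vectors remain to be compared.\<close>
  by (simp add: minus_matrix_vector_mult algebra_simps flip: matrix_vector_mul_assoc)

text \<open>Every \<open>y\<close> is the upper block of some vector of the graph, so invariance
  forces the residual to annihilate all of them.\<close>

lemma right_invariant_graph_iff: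
  "right_invariant f (hamiltonian A R Q) (matrix_graph X) \<longleftrightarrow> riccati_solution f A R Q X"
proof -
  have "right_invariant f (hamiltonian A R Q) (matrix_graph X)
      \<longleftrightarrow> (\<forall>y. riccati_residual f A R Q X *v y = 0)"
    unfolding right_invariant_def
    \<comment> \<open>Only the range of the quantifier is unfolded; the membership to be shown stays
      folded for \<open>stack_vector_in_matrix_graph_iff\<close>.\<close>
    by (subst (1) matrix_graph_def)
      (simp add: hamiltonian_on_graph stack_vector_in_matrix_graph_iff)
  also have "\<dots> \<longleftrightarrow> riccati_residual f A R Q X = 0"
    using matrix_eq[of "riccati_residual f A R Q X" 0] by simp
  finally show ?thesis by (simp add: riccati_solution_iff_residual)
qed

text \<open>With zero residual, the upper block of the eigenvalue equation on the graph is the one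
  for A - R X, and the lower block follows by applying \<open>X\<close>. A graph vector is nonzero
  iff its upper block is.\<close>

lemma rspec_on_graph:
  assumes "riccati_solution f A R Q X"
  shows "rspec_on f (hamiltonian A R Q) (matrix_graph X)
    = rspec f (of_analytic_mat A - of_analytic_mat R ** X)"
  using assms
  by (auto simp: rspec_on_def rspec_def matrix_graph_def hamiltonian_on_graph
      riccati_solution_iff_residual stack_vector_eq_0_iff stack_vector_smult vec.scale)

theorem mainTheorem1:
  fixes f :: "'n::finite analytic_xt ^ 'n"
    and A R Q :: "'n analytic_xt ^ 'n ^ 'n"
  assumes "R = transpose R" and "Q = transpose Q"
  shows
    "(\<forall>(W :: ('n mero ^ ('n + 'n)) set) (U :: 'n mero ^ 'n ^ 'n) (V :: 'n mero ^ 'n ^ 'n).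
        vec.subspace W \<and> vec.dim W = CARD('n) \<and> right_invariant f (hamiltonian A R Q) W \<and>
        W = image_matrix (stack_matrix U V) \<and> regular U
        \<longrightarrow> riccati_solution f A R Q (V ** matrix_inv U) \<and>
            rspec f (of_analytic_mat A - of_analytic_mat R ** (V ** matrix_inv U))
              = rspec_on f (hamiltonian A R Q) W)
     \<and>
     (\<forall>X :: 'n mero ^ 'n ^ 'n. riccati_solution f A R Q X
        \<longrightarrow> (\<exists>U V :: 'n mero ^ 'n ^ 'n. regular U \<and> X = V ** matrix_inv U) \<and>
            (\<forall>U V :: 'n mero ^ 'n ^ 'n. regular U \<and> X = V ** matrix_inv U
              \<longrightarrow> vec.subspace (image_matrix (stack_matrix U V)) \<and>
                  vec.dim (image_matrix (stack_matrix U V)) = CARD('n) \<and>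
                  right_invariant f (hamiltonian A R Q) (image_matrix (stack_matrix U V)) \<and>
                  rspec f (of_analytic_mat A - of_analytic_mat R ** X)
                    = rspec_on f (hamiltonian A R Q) (image_matrix (stack_matrix U V))))"
proof (intro conjI allI impI; (elim conjE)?)
  fix W :: "('n mero ^ ('n + 'n)) set" and U V :: "'n mero ^ 'n ^ 'n"
  assume "right_invariant f (hamiltonian A R Q) W" "W = image_matrix (stack_matrix U V)" "regular U"
  then have W: "W = matrix_graph (V ** matrix_inv U)"
    and inv: "right_invariant f (hamiltonian A R Q) W"
    by (simp_all add: image_stack_matrix_eq_graph)
  from inv show sol: "riccati_solution f A R Q (V ** matrix_inv U)"
    unfolding W right_invariant_graph_iff .
  show "rspec f (of_analytic_mat A - of_analytic_mat R ** (V ** matrix_inv U))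
      = rspec_on f (hamiltonian A R Q) W"
    unfolding W by (rule rspec_on_graph[OF sol, symmetric])
next
  fix X :: "'n mero ^ 'n ^ 'n"
  \<comment> \<open>The witnesses are the identity for \<open>U\<close> and \<open>X\<close> itself
    for \<open>V\<close>.\<close>
  have "X = X ** matrix_inv (mat 1 :: 'n mero ^ 'n ^ 'n)"
    by (simp add: matrix_inv_mat_1)
  then show "\<exists>U V :: 'n mero ^ 'n ^ 'n. regular U \<and> X = V ** matrix_inv U"
    using regular_mat_1 by blast
next
  fix X U V :: "'n mero ^ 'n ^ 'n"
  assume sol: "riccati_solution f A R Q X" and "regular U" "X = V ** matrix_inv U"
  then have W: "image_matrix (stack_matrix U V) = matrix_graph X"
    by (simp add: image_stack_matrix_eq_graph)
  show "vec.subspace (image_matrix (stack_matrix U V))"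
    "vec.dim (image_matrix (stack_matrix U V)) = CARD('n)"
    unfolding W by (rule matrix_graph_subspace_dim)+
  show "right_invariant f (hamiltonian A R Q) (image_matrix (stack_matrix U V))"
    unfolding W right_invariant_graph_iff by (rule sol)
  show "rspec f (of_analytic_mat A - of_analytic_mat R ** X)
      = rspec_on f (hamiltonian A R Q) (image_matrix (stack_matrix U V))"
    unfolding W by (rule rspec_on_graph[OF sol, symmetric])
qed

end
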